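(* Let $(X,S)$ be a hereditary subshift which is intrinsically ergodic and whose measure of maximal entropy has full topological support, i.e., support equal to $X$. Then $(X,S)$ has the Myhill property: every pre-injective cellular automaton $\tau:X\to X$ is surjective.
   Context: $S$ is the left shift on $\{0,1\}^{\mathbb{Z}}$ (product topology), $(Sx)(j)=x(j+1)$. A subshift $(X,S)$ is given by a non-empty closed $X\subset\{0,1\}^{\mathbb{Z}}$ with $S(X)=X$. It is hereditary if $y\in X$ whenever $y\in\{0,1\}^{\mathbb{Z}}$ and $y\le x$ coordinatewise for some $x\in X$. It is intrinsically ergodic if there is exactly one $S$-invariant Borel probability measure on $X$ whose measure-theoretic entropy equals the topological entropy of $(X,S)$ (the measure of maximal entropy). A cellular automaton (CA) on $(X,S)$ is a continuous map $\tau:X\to X$ commuting with $S$. It is pre-injective if for any $x,y\in X$, $\tau(x)=\tau(y)$ implies that either $x=y$ or $x$ and $y$ differ at infinitely many coordinates. *)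

theory Defs
  imports "HOL-Probability.Probability"
begin

text \<open>
  Configurations in \<open>{0,1}\<^sup>\<int>\<close> are functions of type \<^typ>\<open>int \<Rightarrow> bool\<close>, with \<^term>\<open>False\<close> for 0 and
  \<^term>\<open>True\<close> for 1. Topology and order on this type are the library instances: the
  product topology over the discrete two-point space, and the coordinatewise order.
\<close>

type_synonym config = "int \<Rightarrow> bool"

definition shift :: "config \<Rightarrow> config" where
  "shift x = (\<lambda>j. x (j + 1))"

definition subshift :: "config set \<Rightarrow> bool" where
  "subshift X \<longleftrightarrow> X \<noteq> {} \<and> closed X \<and> shift ` X = X"

definition hereditary :: "config set \<Rightarrow> bool" where
  "hereditary X \<longleftrightarrow> (\<forall>x\<in>X. \<forall>y. y \<le> x \<longrightarrow> y \<in> X)"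

text \<open>
  The join of \<open>\<U>\<close>, \<open>T\<^sup>-\<^sup>1\<U>\<close>, \<open>\<dots>\<close>, \<open>T\<^sup>-\<^sup>(\<^sup>n\<^sup>-\<^sup>1\<^sup>)\<U>\<close> for a self-map \<open>T\<close> of \<open>X\<close>, where \<open>\<U>\<close> is a cover or a
  partition of \<open>X\<close>.
\<close>

definition iterated_join :: "'a set \<Rightarrow> ('a \<Rightarrow> 'a) \<Rightarrow> 'a set set \<Rightarrow> nat \<Rightarrow> 'a set set" where
  "iterated_join X T \<U> n = {X \<inter> (\<Inter>i<n. (T ^^ i) -` f i) | f. \<forall>i<n. f i \<in> \<U>}"

definition open_cover :: "'a::topological_space set \<Rightarrow> 'a set set \<Rightarrow> bool" where
  "open_cover X \<U> \<longleftrightarrow> (\<forall>U\<in>\<U>. openin (top_of_set X) U) \<and> \<Union>\<U> = X"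

definition min_subcover_card :: "'a set \<Rightarrow> 'a set set \<Rightarrow> nat" where
  "min_subcover_card X \<U> = (LEAST k. \<exists>\<V>\<subseteq>\<U>. finite \<V> \<and> X \<subseteq> \<Union>\<V> \<and> card \<V> = k)"

text \<open>
  Topological entropy by open covers (Adler, Konheim and McAndrew), intended for compact
  \<open>X\<close> and continuous \<open>T\<close> mapping \<open>X\<close> to itself. The limit in \<open>n\<close> exists by subadditivity, so it equals
  the upper limit used here; the same remark applies to \<open>partition_entropy_rate\<close> below when \<open>T\<close>
  preserves the measure.
\<close>

definition cover_entropy_rate :: "'a set \<Rightarrow> ('a \<Rightarrow> 'a) \<Rightarrow> 'a set set \<Rightarrow> ereal" where
  "cover_entropy_rate X T \<U> =
     limsup (\<lambda>n. ereal (ln (real (min_subcover_card X (iterated_join X T \<U> n))) / real n))"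

definition topological_entropy :: "'a::topological_space set \<Rightarrow> ('a \<Rightarrow> 'a) \<Rightarrow> ereal" where
  "topological_entropy X T = (SUP \<U>\<in>{\<U>. open_cover X \<U>}. cover_entropy_rate X T \<U>)"

text \<open>
  Kolmogorov--Sinai entropy. The convention \<open>0 log 0 = 0\<close> is built in, since
  \<open>0 * ln 0 = 0\<close>; in particular an empty set in an iterated join contributes nothing.
\<close>

definition finite_measurable_partition :: "'a measure \<Rightarrow> 'a set set \<Rightarrow> bool" where
  "finite_measurable_partition M P \<longleftrightarrow> finite P \<and> P \<subseteq> sets M \<and> partition_on (space M) P"

definition partition_entropy :: "'a measure \<Rightarrow> 'a set set \<Rightarrow> real" where
  "partition_entropy M P = - (\<Sum>A\<in>P. measure M A * ln (measure M A))"

definition partition_entropy_rate :: "'a measure \<Rightarrow> ('a \<Rightarrow> 'a) \<Rightarrow> 'a set set \<Rightarrow> ereal" where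
  "partition_entropy_rate M T P =
     limsup (\<lambda>n. ereal (partition_entropy M (iterated_join (space M) T P n) / real n))"

definition measure_entropy :: "'a measure \<Rightarrow> ('a \<Rightarrow> 'a) \<Rightarrow> ereal" where
  "measure_entropy M T =
     (SUP P\<in>{P. finite_measurable_partition M P}. partition_entropy_rate M T P)"

text \<open>Borel probability measures on \<open>X\<close> have \<open>X\<close> itself as their underlying space.\<close>

definition invariant_prob_measure :: "config set \<Rightarrow> config measure \<Rightarrow> bool" where
  "invariant_prob_measure X \<mu> \<longleftrightarrow>
     sets \<mu> = sets (restrict_space borel X) \<and> prob_space \<mu> \<and>
     shift \<in> measurable \<mu> \<mu> \<and> distr \<mu> \<mu> shift = \<mu>"

definition max_entropy_measure :: "config set \<Rightarrow> config measure \<Rightarrow> bool" where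
  "max_entropy_measure X \<mu> \<longleftrightarrow>
     invariant_prob_measure X \<mu> \<and> measure_entropy \<mu> shift = topological_entropy X shift"

definition intrinsically_ergodic :: "config set \<Rightarrow> bool" where
  "intrinsically_ergodic X \<longleftrightarrow> (\<exists>!\<mu>. max_entropy_measure X \<mu>)"

definition measure_support :: "'a::topological_space measure \<Rightarrow> 'a set" where
  "measure_support M =
     {x \<in> space M. \<forall>U. open U \<and> x \<in> U \<longrightarrow> emeasure M (U \<inter> space M) > 0}"

definition cellular_automaton :: "config set \<Rightarrow> (config \<Rightarrow> config) \<Rightarrow> bool" where
  "cellular_automaton X \<tau> \<longleftrightarrow>
     \<tau> ` X \<subseteq> X \<and> continuous_on X \<tau> \<and> (\<forall>x\<in>X. \<tau> (shift x) = shift (\<tau> x))"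

definition pre_injective :: "config set \<Rightarrow> (config \<Rightarrow> config) \<Rightarrow> bool" where
  "pre_injective X \<tau> \<longleftrightarrow>
     (\<forall>x\<in>X. \<forall>y\<in>X. \<tau> x = \<tau> y \<longrightarrow> x = y \<or> infinite {j. x j \<noteq> y j})"

definition Myhill_property :: "config set \<Rightarrow> bool" where
  "Myhill_property X \<longleftrightarrow>
     (\<forall>\<tau>. cellular_automaton X \<tau> \<and> pre_injective X \<tau> \<longrightarrow> \<tau> ` X = X)"

end

(*
  Let r be a radius of the pre-injective automaton \<tau>. Heredity allows a configuration to be cut off
  outside an interval, and pre-injectivity separates distinct cut-offs. Hence a word of length n
  of x is determined by the word of \<tau> x at the same place together with at most 4r further bits, so
  passing from the measure of maximal entropy to its image under \<tau> does not lower the entropy of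
  window partitions. Finite windows approximate every finite partition (Kolmogorov--Sinai), so the
  image measure has maximal entropy too and equals the original measure by uniqueness. The image
  measure gives no mass to the complement of the compact set \<tau>(X), so full support forces \<tau>(X) = X.
*)

theory Submission imports Defs begin

section \<open>Entropy of simple functions\<close>

text \<open>Pre-injectivity says nothing about two points that differ at infinitely many places, so
  a point of \<open>X\<close> need not be recoverable from its image. Only finite blocks can be
  compared. The image of a point cut off outside a block is under control well inside the block and
  far away from it, but within distance r of an end it depends on the cut and cannot be read off
  \<tau> x. Each end spoils 2r positions; these are the 4r extra bits. Their number does not grow
  with the block, so their cost of at most 4r ln 2 vanishes from the entropy per symbol. The
  opposite inequality is that a factor has no more entropy than the system above it.

  Entropy is attached to finite-valued functions instead of partitions. That one word determines
  another is then a statement about functions, common refinement becomes pairing, and the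
  inequalities for entropies of random variables apply.\<close>

definition fun_entropy :: "'a measure \<Rightarrow> ('a \<Rightarrow> 'b) \<Rightarrow> real" where
  "fun_entropy M f =
     - (\<Sum>v\<in>f ` space M. measure M (f -` {v} \<inter> space M) * ln (measure M (f -` {v} \<inter> space M)))"

lemma fun_entropy_superset:
  assumes "finite A" "f ` space M \<subseteq> A"
  shows "fun_entropy M f =
    - (\<Sum>v\<in>A. measure M (f -` {v} \<inter> space M) * ln (measure M (f -` {v} \<inter> space M)))"
proof -
  have "measure M (f -` {v} \<inter> space M) = 0" if "v \<notin> f ` space M" for v
  proof -
    have "f -` {v} \<inter> space M = {}"
      using that by auto
    then show ?thesis by simp
  qed
  then show ?thesis
    unfolding fun_entropy_def by (intro arg_cong[where f=uminus] sum.mono_neutral_left assms) auto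
qed

lemma fun_entropy_cong:
  assumes "\<And>x. x \<in> space M \<Longrightarrow> f x = g x"
  shows "fun_entropy M f = fun_entropy M g"
proof -
  have "f ` space M = g ` space M" "\<And>v. f -` {v} \<inter> space M = g -` {v} \<inter> space M"
    using assms by auto
  then show ?thesis
    unfolding fun_entropy_def by simp
qed

lemma fun_entropy_distr:
  assumes "T \<in> measurable M N" "simple_function N f"
  shows "fun_entropy (distr M N T) f = fun_entropy M (f \<circ> T)"
proof -
  have "fun_entropy M (f \<circ> T) = - (\<Sum>v\<in>f ` space N.
      measure M ((f \<circ> T) -` {v} \<inter> space M) * ln (measure M ((f \<circ> T) -` {v} \<inter> space M)))"
    using assms by (intro fun_entropy_superset) (auto simp: simple_function_def dest: measurable_space)
  moreover have "measure (distr M N T) (f -` {v} \<inter> space N) = measure M ((f \<circ> T) -` {v} \<inter> space M)" for v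
  proof -
    have "T -` (f -` {v} \<inter> space N) \<inter> space M = (f \<circ> T) -` {v} \<inter> space M"
      using measurable_space[OF assms(1)] by auto
    then show ?thesis
      using simple_functionD(2)[OF assms(2)] by (simp add: measure_distr[OF assms(1)])
  qed
  ultimately show ?thesis
    by (simp add: fun_entropy_def)
qed

text \<open>For values of small probability: an explicit bound that tends to 0 with p. It is ln t
  \<le> t - 1 at t = 1 / sqrt p; the square root is what survives multiplication by p.\<close>

lemma neg_mult_ln_le_sqrt:
  fixes p :: real
  assumes "0 \<le> p"
  shows "- (p * ln p) \<le> 2 * sqrt p"
proof (cases "p = 0")
  case False
  then have p: "p > 0" using assms by simp
  have "- ln p = 2 * ln (1 / sqrt p)"
    using p by (simp add: ln_div ln_sqrt)
  also have "\<dots> \<le> 2 * (1 / sqrt p)"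
    using p ln_le_minus_one[of "1 / sqrt p"] by simp
  finally have "p * (- ln p) \<le> p * (2 * (1 / sqrt p))"
    using p by (intro mult_left_mono) auto
  also have "\<dots> = 2 * (p / sqrt p)"
    by simp
  also have "p / sqrt p = sqrt p"
    using p by (simp add: real_div_sqrt)
  finally show ?thesis by simp
qed simp

text \<open>The counterpart for a value of probability close to 1, again from ln t \<le> t - 1, now
  at t = 1 / p.\<close>

lemma neg_mult_ln_le_one_minus:
  fixes p :: real
  assumes "0 < p"
  shows "- (p * ln p) \<le> 1 - p"
proof -
  have "p * ln (1 / p) \<le> p * (1 / p - 1)"
    using assms ln_le_minus_one[of "1 / p"] by (intro mult_left_mono) auto
  then show ?thesis
    using assms by (simp add: ln_div algebra_simps)
qed

section \<open>Information inequalities for simple functions\<close>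

context prob_space
begin

text \<open>Base \<open>exp 1\<close> turns \<open>log\<close> into \<open>ln\<close>; through this
  equation data processing, the chain rule and the cardinality bound carry over to
  \<open>fun_entropy\<close>.\<close>

lemma fun_entropy_eq_entropy:
  assumes "simple_function M f"
  shows "fun_entropy M f = entropy (exp 1) (count_space (f ` space M)) f"
proof -
  interpret information_space M "exp 1"
    by unfold_locales simp
  show ?thesis
    by (simp add: entropy_simple_distributed[OF simple_distributedI[OF assms measure_nonneg refl]]
        fun_entropy_def log_def)
qed

text \<open>A function that is constant on the fibres of \<open>f\<close> factors through
  \<open>f\<close>, and data processing applies. Every later argument of the form "these data
  determine those" enters through this lemma.\<close>

lemma fun_entropy_mono:
  assumes f: "simple_function M f"
    and det: "\<And>x y. x \<in> space M \<Longrightarrow> y \<in> space M \<Longrightarrow> f x = f y \<Longrightarrow> g x = g y"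
  shows "fun_entropy M g \<le> fun_entropy M f"
proof -
  interpret information_space M "exp 1"
    by unfold_locales simp
  define \<phi> where "\<phi> v = g (SOME x. x \<in> space M \<and> f x = v)" for v
  have "g x = (\<phi> \<circ> f) x" if "x \<in> space M" for x
  proof -
    have "(SOME y. y \<in> space M \<and> f y = f x) \<in> space M \<and> f (SOME y. y \<in> space M \<and> f y = f x) = f x"
      by (rule someI[of _ x]) (use that in simp)
    then have "g (SOME y. y \<in> space M \<and> f y = f x) = g x"
      using det that by blast
    then show ?thesis
      by (simp add: \<phi>_def)
  qed
  then have "fun_entropy M g = fun_entropy M (\<phi> \<circ> f)"
    by (rule fun_entropy_cong)
  also have "\<dots> \<le> fun_entropy M f"
    using entropy_data_processing[OF f, of \<phi>] f
    by (simp add: fun_entropy_eq_entropy simple_function_compose)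
  finally show ?thesis .
qed

lemma fun_entropy_Pair_le:
  assumes "simple_function M f" "simple_function M g"
  shows "fun_entropy M (\<lambda>x. (f x, g x)) \<le> fun_entropy M f + fun_entropy M g"
proof -
  interpret information_space M "exp 1"
    by unfold_locales simp
  show ?thesis
    unfolding fun_entropy_eq_entropy[OF assms(1)] fun_entropy_eq_entropy[OF assms(2)]
      fun_entropy_eq_entropy[OF simple_function_Pair[OF assms]] entropy_chain_rule[OF assms]
    using conditional_entropy_less_eq_entropy[OF assms(2,1)] by (rule add_left_mono)
qed

lemma fun_entropy_le_ln_card:
  assumes "simple_function M f"
  shows "fun_entropy M f \<le> ln (card (f ` space M))"
proof -
  interpret information_space M "exp 1"
    by unfold_locales simp
  show ?thesis
    using entropy_le_card[OF simple_distributedI[OF assms measure_nonneg refl]] assms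
    by (simp add: fun_entropy_eq_entropy log_def)
qed

text \<open>The function records the correction that turns \<open>g\<close> into \<open>f\<close>.
  Its value \<open>None\<close> has probability at least 1 - \<delta>, positive because \<delta> <
  1, and contributes at most \<delta>. Every other value lies in the disagreement set, so it has
  probability at most \<delta> and contributes at most 2 sqrt \<delta>.\<close>

lemma fun_entropy_error_le:
  assumes f: "simple_function M f" and g: "simple_function M g"
    and \<delta>: "prob {x \<in> space M. f x \<noteq> g x} \<le> \<delta>" "\<delta> < 1"
  shows "fun_entropy M (\<lambda>x. if f x = g x then None else Some (f x))
    \<le> \<delta> + 2 * real (card (f ` space M)) * sqrt \<delta>"
proof -
  let ?e = "\<lambda>x. if f x = g x then None else Some (f x)"
  let ?p = "\<lambda>v. prob (?e -` {v} \<inter> space M)"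
  have fin: "finite (f ` space M)"
    using f by (rule simple_functionD)
  have D: "{x \<in> space M. f x \<noteq> g x} \<in> events"
  proof -
    have "simple_function M (\<lambda>x. (f x, g x))"
      using f g by (rule simple_function_Pair)
    from simple_functionD(2)[OF this, of "{(u, v). u \<noteq> v}"] show ?thesis
      by (simp add: vimage_def Int_def conj_commute)
  qed
  have "fun_entropy M ?e = - (\<Sum>v\<in>insert None (Some ` f ` space M). ?p v * ln (?p v))"
    using fin by (intro fun_entropy_superset) auto
  also have "\<dots> = - (?p None * ln (?p None)) + (\<Sum>v\<in>f ` space M. - (?p (Some v) * ln (?p (Some v))))"
    using fin by (simp add: sum.reindex sum_negf)
  also have "\<dots> \<le> \<delta> + (\<Sum>v\<in>f ` space M. 2 * sqrt \<delta>)"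
  proof (intro add_mono sum_mono)
    have "?e -` {None} \<inter> space M = space M - {x \<in> space M. f x \<noteq> g x}"
      by auto
    then have "?p None = 1 - prob {x \<in> space M. f x \<noteq> g x}"
      using prob_compl[OF D] by simp
    then show "- (?p None * ln (?p None)) \<le> \<delta>"
      using neg_mult_ln_le_one_minus[of "?p None"] \<delta> by linarith
  next
    fix v
    have "?p (Some v) \<le> prob {x \<in> space M. f x \<noteq> g x}"
      by (intro finite_measure_mono D) (auto split: if_splits)
    then have "sqrt (?p (Some v)) \<le> sqrt \<delta>"
      using \<delta> by simp
    then show "- (?p (Some v) * ln (?p (Some v))) \<le> 2 * sqrt \<delta>"
      using neg_mult_ln_le_sqrt[OF measure_nonneg, of M "?e -` {Some v} \<inter> space M"] by linarith
  qed
  finally show ?thesis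
    by (simp add: mult_ac)
qed

end

section \<open>Partitions and itineraries\<close>

text \<open>Indexing by attained values keeps the empty set out, as \<open>partition_on\<close>
  demands.\<close>

definition level_sets :: "'a measure \<Rightarrow> ('a \<Rightarrow> 'b) \<Rightarrow> 'a set set" where
  "level_sets M f = (\<lambda>v. f -` {v} \<inter> space M) ` f ` space M"

lemma finite_measurable_partition_level_sets:
  assumes "simple_function M f"
  shows "finite_measurable_partition M (level_sets M f)"
  using simple_functionD[OF assms]
  by (auto simp: finite_measurable_partition_def level_sets_def partition_on_def disjoint_def)

text \<open>The function sends a point to its own cell, so its values are sets. This lets a
  statement about all finite partitions be proved for simple functions.\<close>

lemma finite_measurable_partition_eq_level_sets:
  assumes "finite_measurable_partition M P"
  obtains f :: "'a \<Rightarrow> 'a set" where "simple_function M f" "P = level_sets M f"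
proof
  define f where "f x = (THE A. A \<in> P \<and> x \<in> A)" for x
  have P: "finite P" "P \<subseteq> sets M" "partition_on (space M) P"
    using assms by (auto simp: finite_measurable_partition_def)
  have f_eq: "f x = A" if "A \<in> P" "x \<in> A" for x A
    unfolding f_def using that P(3) by (intro the_equality) (auto simp: partition_on_def disjoint_def)
  have fibre: "f -` {A} \<inter> space M = A" if "A \<in> P" for A
    using that P(3) f_eq by (auto simp: partition_on_def) blast
  have range: "f ` space M = P"
  proof
    show "f ` space M \<subseteq> P"
    proof safe
      fix x assume "x \<in> space M"
      then obtain A where "A \<in> P" "x \<in> A"
        using P(3) by (auto simp: partition_on_def)
      then show "f x \<in> P"
        using f_eq by simp
    qed
    show "P \<subseteq> f ` space M"
    proof
      fix A assume A: "A \<in> P"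
      then have "A \<noteq> {}" using P(3) by (auto simp: partition_on_def)
      then obtain x where "x \<in> A" by auto
      then show "A \<in> f ` space M"
        using A f_eq P(3) by (intro image_eqI[of _ _ x]) (auto simp: partition_on_def)
    qed
  qed
  show "simple_function M f"
    unfolding simple_function_def range using P fibre by auto
  show "P = level_sets M f"
    unfolding level_sets_def range using fibre by auto
qed

definition itinerary :: "('a \<Rightarrow> 'a) \<Rightarrow> ('a \<Rightarrow> 'b) \<Rightarrow> nat \<Rightarrow> 'a \<Rightarrow> 'b list" where
  "itinerary T f n x = map (\<lambda>i. f ((T ^^ i) x)) [0..<n]"

lemma itinerary_eq_iff:
  "itinerary T f n x = itinerary T f n y \<longleftrightarrow> (\<forall>i<n. f ((T ^^ i) x) = f ((T ^^ i) y))"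
  by (auto simp: itinerary_def)

lemma itinerary_Suc: "itinerary T f (Suc n) x = itinerary T f n x @ [f ((T ^^ n) x)]"
  by (simp add: itinerary_def)

lemma simple_function_comp_measurable:
  assumes "T \<in> measurable M N" "simple_function N f"
  shows "simple_function M (f \<circ> T)"
  unfolding simple_function_def
proof safe
  have "(f \<circ> T) ` space M \<subseteq> f ` space N"
    using measurable_space[OF assms(1)] by auto
  then show "finite ((f \<circ> T) ` space M)"
    using simple_functionD(1)[OF assms(2)] finite_subset by blast
next
  fix x
  have "(f \<circ> T) -` {(f \<circ> T) x} \<inter> space M = T -` (f -` {f (T x)} \<inter> space N) \<inter> space M"
    using measurable_space[OF assms(1)] by auto
  then show "(f \<circ> T) -` {(f \<circ> T) x} \<inter> space M \<in> sets M"
    using measurable_sets[OF assms(1) simple_functionD(2)[OF assms(2)]] by metis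
qed

lemma simple_function_itinerary:
  assumes T: "T \<in> measurable M M" and f: "simple_function M f"
  shows "simple_function M (itinerary T f n)"
proof (induction n)
  case 0
  show ?case by (simp add: itinerary_def)
next
  case (Suc n)
  have "simple_function M (f \<circ> (T ^^ n))"
    using measurable_compose_n[OF T] f by (rule simple_function_comp_measurable)
  from simple_function_compose[OF simple_function_Pair[OF Suc this], of "\<lambda>(l, v). l @ [v]"]
  show ?case
    by (simp add: itinerary_Suc[abs_def] comp_def)
qed

text \<open>The non-empty members of the join are exactly the fibres of the itinerary. The join may
  also contain the empty set, whose summand is 0.\<close>

lemma partition_entropy_iterated_join:
  assumes T: "T \<in> measurable M M" and f: "simple_function M f"
  shows "partition_entropy M (iterated_join (space M) T (level_sets M f) n)
    = fun_entropy M (itinerary T f n)"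
proof -
  let ?F = "itinerary T f n"
  let ?J = "iterated_join (space M) T (level_sets M f) n"
  have Tn: "(T ^^ i) x \<in> space M" if "x \<in> space M" for x i
    using measurable_space[OF measurable_compose_n[OF T]] that by blast
  have fibre: "?F -` {?F x} \<inter> space M = {y \<in> space M. \<forall>i<n. f ((T ^^ i) y) = f ((T ^^ i) x)}" for x
    by (auto simp: itinerary_eq_iff)
  have sub: "level_sets M ?F \<subseteq> ?J"
  proof
    fix A assume "A \<in> level_sets M ?F"
    then obtain x where x: "x \<in> space M" "A = ?F -` {?F x} \<inter> space M"
      by (auto simp: level_sets_def)
    have "A = space M \<inter> (\<Inter>i<n. (T ^^ i) -` (f -` {f ((T ^^ i) x)} \<inter> space M))"
      unfolding x(2) fibre using Tn by auto
    moreover have "\<forall>i<n. f -` {f ((T ^^ i) x)} \<inter> space M \<in> level_sets M f"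
      using Tn x by (auto simp: level_sets_def)
    ultimately show "A \<in> ?J"
      unfolding iterated_join_def mem_Collect_eq
      by (intro exI[of _ "\<lambda>i. f -` {f ((T ^^ i) x)} \<inter> space M"] conjI)
  qed
  have sup: "?J \<subseteq> insert {} (level_sets M ?F)"
  proof
    fix A assume "A \<in> ?J"
    then obtain c where A: "A = space M \<inter> (\<Inter>i<n. (T ^^ i) -` c i)" and c: "\<forall>i<n. c i \<in> level_sets M f"
      by (auto simp: iterated_join_def)
    have "\<exists>v. i < n \<longrightarrow> c i = f -` {v} \<inter> space M" for i
      using c by (fastforce simp: level_sets_def)
    then obtain v where v: "\<And>i. i < n \<Longrightarrow> c i = f -` {v i} \<inter> space M"
      by metis
    show "A \<in> insert {} (level_sets M ?F)"
    proof (cases "A = {}")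
      case False
      then obtain x where x: "x \<in> A" by auto
      have "A = ?F -` {?F x} \<inter> space M"
        using x Tn v unfolding fibre A by auto
      then show ?thesis
        using x unfolding A level_sets_def by auto
    qed simp
  qed
  have fin: "finite (level_sets M ?F)"
    using simple_functionD(1)[OF simple_function_itinerary[OF T f]] by (simp add: level_sets_def)
  have inj: "inj_on (\<lambda>v. ?F -` {v} \<inter> space M) (?F ` space M)"
    by (auto simp: inj_on_def)
  have "(\<Sum>A\<in>?J. measure M A * ln (measure M A)) = (\<Sum>A\<in>level_sets M ?F. measure M A * ln (measure M A))"
    using sub sup fin finite_subset[OF sup] by (intro sum.mono_neutral_right) auto
  also have "\<dots> = (\<Sum>v\<in>?F ` space M. measure M (?F -` {v} \<inter> space M) * ln (measure M (?F -` {v} \<inter> space M)))"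
    unfolding level_sets_def by (subst sum.reindex[OF inj]) simp
  finally show ?thesis
    by (simp add: partition_entropy_def fun_entropy_def)
qed

lemma partition_entropy_rate_level_sets:
  assumes "T \<in> measurable M M" "simple_function M f"
  shows "partition_entropy_rate M T (level_sets M f) =
    limsup (\<lambda>n. ereal (fun_entropy M (itinerary T f n) / real n))"
  using assms by (simp add: partition_entropy_rate_def partition_entropy_iterated_join)

lemma partition_entropy_rate_le_measure_entropy:
  assumes "finite_measurable_partition M P"
  shows "partition_entropy_rate M T P \<le> measure_entropy M T"
  unfolding measure_entropy_def using assms by (auto intro: SUP_upper)

section \<open>Entropy of itineraries under a measure-preserving map\<close>

locale measure_preserving_system = prob_space +
  fixes T
  assumes T[measurable]: "T \<in> measurable M M" and distr_T: "distr M M T = M"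
begin

lemma distr_funpow: "distr M M (T ^^ n) = M"
proof (induction n)
  case (Suc n)
  have "distr M M (T ^^ Suc n) = distr (distr M M (T ^^ n)) M T"
    using distr_distr[OF T measurable_compose_n[OF T, of n]] by (simp only: funpow.simps)
  then show ?case
    by (simp only: Suc distr_T)
qed (simp add: distr_id2 id_def)

lemma fun_entropy_funpow:
  assumes "simple_function M f"
  shows "fun_entropy M (f \<circ> (T ^^ n)) = fun_entropy M f"
  using fun_entropy_distr[OF measurable_compose_n[OF T] assms, of n] by (simp add: distr_funpow)

text \<open>By invariance every entry of the itinerary has the entropy of \<open>f\<close>, and
  entropy is subadditive under pairing.\<close>

lemma fun_entropy_itinerary_le:
  assumes f: "simple_function M f"
  shows "fun_entropy M (itinerary T f n) \<le> n * fun_entropy M f"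
proof (induction n)
  case 0
  have "fun_entropy M (itinerary T f 0) \<le> ln (card (itinerary T f 0 ` space M))"
    by (intro fun_entropy_le_ln_card simple_function_itinerary T f)
  also have "itinerary T f 0 ` space M = {[]}"
    using not_empty by (auto simp: itinerary_def)
  finally show ?case by simp
next
  case (Suc n)
  have fn: "simple_function M (f \<circ> (T ^^ n))"
    using measurable_compose_n[OF T] f by (rule simple_function_comp_measurable)
  note i = simple_function_itinerary[OF T f]
  have "fun_entropy M (itinerary T f (Suc n)) \<le> fun_entropy M (\<lambda>x. (itinerary T f n x, (f \<circ> (T ^^ n)) x))"
    by (intro fun_entropy_mono simple_function_Pair i fn) (auto simp: itinerary_Suc)
  also have "\<dots> \<le> fun_entropy M (itinerary T f n) + fun_entropy M (f \<circ> (T ^^ n))"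
    by (intro fun_entropy_Pair_le i fn)
  also have "\<dots> \<le> Suc n * fun_entropy M f"
    using Suc fun_entropy_funpow[OF f] by (simp add: algebra_simps)
  finally show ?case .
qed

text \<open>Knowing \<open>g\<close> and the places where \<open>g\<close> is wrong, with the correction, one recovers \<open>f\<close>.\<close>

lemma fun_entropy_itinerary_approx:
  assumes f: "simple_function M f" and g: "simple_function M g"
  shows "fun_entropy M (itinerary T f n) \<le> fun_entropy M (itinerary T g n)
    + n * fun_entropy M (\<lambda>x. if f x = g x then None else Some (f x))"
proof -
  define e where "e x = (if f x = g x then None else Some (f x))" for x
  have e: "simple_function M e"
    using simple_function_compose[OF simple_function_Pair[OF f g],
        of "\<lambda>(u, v). if u = v then None else Some u"]
    by (simp add: comp_def e_def[abs_def])
  have det: "f x = f y" if "g x = g y" "e x = e y" for x y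
    using that by (auto simp: e_def split: if_splits)
  have "fun_entropy M (itinerary T f n) \<le> fun_entropy M (\<lambda>x. (itinerary T g n x, itinerary T e n x))"
    by (intro fun_entropy_mono simple_function_Pair simple_function_itinerary[OF T] e g)
      (auto simp: itinerary_eq_iff intro: det)
  also have "\<dots> \<le> fun_entropy M (itinerary T g n) + fun_entropy M (itinerary T e n)"
    by (intro fun_entropy_Pair_le simple_function_itinerary[OF T] e g)
  also have "\<dots> \<le> fun_entropy M (itinerary T g n) + n * fun_entropy M e"
    using fun_entropy_itinerary_le[OF e] by simp
  finally show ?thesis
    by (simp add: e_def[abs_def])
qed

end

section \<open>Approximation by finite windows\<close>

text \<open>Needed for \<open>sets_PiM_equal_borel\<close>: the Borel sets of the configuration
  space are generated by conditions on single coordinates.\<close>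

instance bool :: second_countable_topology
proof
  have "open = generate_topology (UNIV :: bool set set)"
    by (intro ext) (simp add: discrete_topology_class.open_discrete generate_topology.Basis)
  moreover have "countable (UNIV :: bool set set)"
    by simp
  ultimately show "\<exists>B :: bool set set. countable B \<and> open = generate_topology B"
    by blast
qed

text \<open>A word on [-N, N] is encoded as a configuration that vanishes elsewhere. Words of all
  lengths then share one type, and a smaller window can be taken of a larger one.\<close>

definition window :: "nat \<Rightarrow> config \<Rightarrow> config" where
  "window N x = (\<lambda>j. \<bar>j\<bar> \<le> int N \<and> x j)"

lemma window_eq_iff: "window N x = window N y \<longleftrightarrow> (\<forall>j. \<bar>j\<bar> \<le> int N \<longrightarrow> x j = y j)"
  by (auto simp: window_def fun_eq_iff)

lemma window_window: "N \<le> N' \<Longrightarrow> window N (window N' x) = window N x"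
  by (auto simp: window_def fun_eq_iff)

lemma finite_supported_configs:
  assumes "finite B"
  shows "finite {x :: config. \<forall>j. x j \<longrightarrow> j \<in> B}" "card {x :: config. \<forall>j. x j \<longrightarrow> j \<in> B} = 2 ^ card B"
proof -
  have "bij_betw Collect {x :: config. \<forall>j. x j \<longrightarrow> j \<in> B} (Pow B)"
    by (rule bij_betw_byWitness[of _ "\<lambda>A j. j \<in> A"]) auto
  then show "finite {x :: config. \<forall>j. x j \<longrightarrow> j \<in> B}" "card {x :: config. \<forall>j. x j \<longrightarrow> j \<in> B} = 2 ^ card B"
    using assms by (auto simp: bij_betw_finite bij_betw_same_card card_Pow)
qed

locale config_prob_space = prob_space M for M :: "config measure" +
  fixes X
  assumes sets_M: "sets M = sets (restrict_space borel X)"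
begin

lemma space_M: "space M = X"
  using sets_eq_imp_space_eq[OF sets_M] by (simp add: space_restrict_space)

lemma Int_in_events: "A \<in> sets borel \<Longrightarrow> X \<inter> A \<in> events"
  unfolding sets_M by (auto simp: sets_restrict_space)

lemma coordinate_in_events: "{x \<in> X. x j} \<in> events"
proof -
  have "open ((\<lambda>x :: config. x j) -` {True})"
    by (rule open_vimage[OF discrete_topology_class.open_discrete continuous_on_product_coordinates])
  then have "X \<inter> (\<lambda>x :: config. x j) -` {True} \<in> events"
    by (intro Int_in_events) auto
  moreover have "X \<inter> (\<lambda>x :: config. x j) -` {True} = {x \<in> X. x j}"
    by auto
  ultimately show ?thesis by simp
qed

lemma simple_function_window: "simple_function M (window N)"
  unfolding simple_function_def
proof safe
  have "window N ` space M \<subseteq> {x. \<forall>j. x j \<longrightarrow> j \<in> {- int N..int N}}"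
    by (auto simp: window_def)
  then show "finite (window N ` space M)"
    by (rule finite_subset) (rule finite_supported_configs, simp)
next
  fix x
  have *: "{y \<in> X. y j = b} \<in> events" for j b
  proof -
    have "{y \<in> X. y j = b} = (if b then {y \<in> X. y j} else space M - {y \<in> X. y j})"
      by (auto simp: space_M)
    then show ?thesis
      using coordinate_in_events[of j] by auto
  qed
  have "window N -` {window N x} \<inter> space M
    = space M \<inter> (\<Inter>j\<in>{- int N..int N}. {y \<in> X. y j = x j})"
    by (fastforce simp: window_eq_iff space_M)
  also have "\<dots> \<in> events"
    by (intro sets.Int sets.top sets.finite_INT) (use * in auto)
  finally show "window N -` {window N x} \<inter> space M \<in> events" .
qed

lemma window_vimage_in_events: "X \<inter> window N -` B \<in> events"
  using simple_functionD(2)[OF simple_function_window, of N B] by (simp add: space_M Int_commute)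

text \<open>The sets that can be approximated to every precision by window conditions contain the
  coordinate sets and are closed under complements and countable unions. The induction keeps
  \<delta> arbitrary because the union step calls it with a smaller precision.\<close>

lemma borel_approx_window:
  assumes "C \<in> sets borel" "\<delta> > 0"
  shows "\<exists>N B. prob {x \<in> X. (x \<in> C) \<noteq> (window N x \<in> B)} < \<delta>"
proof -
  have disagree: "{x \<in> X. (x \<in> C) \<noteq> (window N x \<in> B)} \<in> events" if "C \<in> sets borel" for C N B
  proof -
    have "{x \<in> X. (x \<in> C) \<noteq> (window N x \<in> B)} =
      (X \<inter> C - X \<inter> window N -` B) \<union> (X \<inter> window N -` B - X \<inter> C)"
      by auto
    then show ?thesis
      using Int_in_events[OF that] window_vimage_in_events by auto
  qed
  have sets_borel: "sets (borel :: config measure) =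
      sigma_sets UNIV {{f. f i \<in> A} | i A. A \<in> sets borel}"
    using sets_PiM_single[of UNIV "\<lambda>_ :: int. borel :: bool measure"]
    by (simp add: sets_PiM_equal_borel)
  from assms(1) have "C \<in> sigma_sets UNIV {{f :: config. f i \<in> A} | i A. A \<in> sets borel}"
    by (simp add: sets_borel)
  then show ?thesis
    using \<open>\<delta> > 0\<close>
  proof (induction arbitrary: \<delta> rule: sigma_sets.induct)
    case (Basic C)
    then obtain i A where C: "C = {f :: config. f i \<in> A}" by auto
    \<comment> \<open>A condition on coordinate i is decided exactly by any window that reaches
      i.\<close>
    have "{x \<in> X. (x \<in> C) \<noteq> (window (nat \<bar>i\<bar>) x \<in> C)} = {}"
      by (auto simp: C window_def)
    then have "prob {x \<in> X. (x \<in> C) \<noteq> (window (nat \<bar>i\<bar>) x \<in> C)} < \<delta>"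
      using Basic by (simp del: Collect_empty_eq)
    then show ?case by blast
  next
    case Empty
    have "prob {x \<in> X. (x \<in> {}) \<noteq> (window 0 x \<in> {})} < \<delta>"
      using Empty by simp
    then show ?case by blast
  next
    case (Compl C)
    then obtain N B where "prob {x \<in> X. (x \<in> C) \<noteq> (window N x \<in> B)} < \<delta>"
      by blast
    also have "{x \<in> X. (x \<in> C) \<noteq> (window N x \<in> B)} = {x \<in> X. (x \<in> UNIV - C) \<noteq> (window N x \<in> - B)}"
      by auto
    finally show ?case by blast
  next
    case (Union C)
    have C: "C i \<in> sets borel" for i :: nat
      using Union(1) unfolding sets_borel .
    \<comment> \<open>Half of \<delta> pays for replacing the union by its first m members, the
      other half is shared among their m approximations. \<open>Suc m\<close> in the denominator
      avoids division by 0 when m = 0.\<close>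
    define D where "D n = X \<inter> (\<Union>i<n. C i)" for n :: nat
    have D: "range D \<subseteq> events"
      unfolding D_def using C by (auto intro!: Int_in_events)
    have "incseq D"
      by (rule incseq_SucI) (auto simp: D_def less_Suc_eq)
    from finite_Lim_measure_incseq[OF D this]
    have "(\<lambda>n. prob (D n)) \<longlonglongrightarrow> prob (\<Union>n. D n)" .
    moreover have "prob (\<Union>n. D n) - \<delta> / 2 < prob (\<Union>n. D n)"
      using Union by simp
    ultimately have "eventually (\<lambda>n. prob (\<Union>n. D n) - \<delta> / 2 < prob (D n)) sequentially"
      by (rule order_tendstoD)
    then obtain m where m: "prob (\<Union>n. D n) - \<delta> / 2 < prob (D m)"
      by (auto simp: eventually_sequentially)
    have "\<forall>i. \<exists>N B. prob {x \<in> X. (x \<in> C i) \<noteq> (window N x \<in> B)} < \<delta> / (2 * Suc m)"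
      using Union by simp
    then obtain N B where NB: "\<forall>i. prob {x \<in> X. (x \<in> C i) \<noteq> (window (N i) x \<in> B i)} < \<delta> / (2 * Suc m)"
      unfolding choice_iff by (elim exE)
    \<comment> \<open>One window large enough to contain all the smaller ones; the inserted 0 keeps
      the set non-empty when m = 0.\<close>
    define K where "K = Max (insert 0 (N ` {..<m}))"
    have K: "N i \<le> K" if "i < m" for i
      unfolding K_def using that by (intro Max_ge) auto
    let ?B = "\<Union>i<m. window (N i) -` B i"
    let ?E = "\<lambda>i. {x \<in> X. (x \<in> C i) \<noteq> (window (N i) x \<in> B i)}"
    have "{x \<in> X. (x \<in> (\<Union>i. C i)) \<noteq> (window K x \<in> ?B)} \<subseteq> ((\<Union>n. D n) - D m) \<union> (\<Union>i<m. ?E i)"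
      using K by (auto simp: D_def window_window)
    then have "prob {x \<in> X. (x \<in> (\<Union>i. C i)) \<noteq> (window K x \<in> ?B)} \<le> prob (((\<Union>n. D n) - D m) \<union> (\<Union>i<m. ?E i))"
      by (intro finite_measure_mono sets.Un sets.Diff sets.finite_UN sets.countable_UN D disagree C)
        (use D in auto)
    also have "\<dots> \<le> prob ((\<Union>n. D n) - D m) + prob (\<Union>i<m. ?E i)"
      by (intro measure_Un_le sets.Diff sets.finite_UN sets.countable_UN D disagree C)
        (use D in auto)
    also have "prob ((\<Union>n. D n) - D m) = prob (\<Union>n. D n) - prob (D m)"
      by (intro finite_measure_Diff sets.countable_UN D) (use D in auto)
    also have "prob (\<Union>i<m. ?E i) \<le> (\<Sum>i<m. prob (?E i))"
      by (intro finite_measure_subadditive_finite) (use disagree C in auto)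
    also have "\<dots> \<le> (\<Sum>i<m. \<delta> / (2 * Suc m))"
      using NB by (intro sum_mono less_imp_le) blast
    also have "\<dots> \<le> \<delta> / 2"
      using Union(3) by (simp add: field_simps)
    finally have "prob {x \<in> X. (x \<in> (\<Union>i. C i)) \<noteq> (window K x \<in> ?B)} < \<delta>"
      using m by simp
    then show ?case by blast
  qed
qed

text \<open>Each fibre of \<open>f\<close> gets its own approximate window test, and
  \<open>h\<close> returns a value whose test accepts. Outside the union of the finitely many error
  sets only the true value is accepted, so the choice made by \<open>h\<close> is forced
  there.\<close>

lemma simple_function_approx_window:
  assumes f: "simple_function M f" and "\<delta> > 0"
  obtains N h where "prob {x \<in> X. f x \<noteq> h (window N x)} < \<delta>"
proof -
  let ?V = "f ` X"
  have fin: "finite ?V"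
    using simple_functionD(1)[OF f] by (simp add: space_M)
  \<comment> \<open>One more than the number of values, so that the errors add up to strictly less
    than \<delta>.\<close>
  define k where "k = Suc (card ?V)"
  have "\<exists>N B. prob {x \<in> X. (f x = v) \<noteq> (window N x \<in> B)} < \<delta> / k" for v
  proof -
    have "f -` {v} \<inter> space M \<in> events"
      using f by (rule simple_functionD)
    then obtain C where C: "C \<in> sets borel" "f -` {v} \<inter> space M = X \<inter> C"
      unfolding sets_M by (auto simp: sets_restrict_space)
    then have eq: "{x \<in> X. (f x = v) \<noteq> (window N x \<in> B)} = {x \<in> X. (x \<in> C) \<noteq> (window N x \<in> B)}" for N B
      by (auto simp: space_M)
    show ?thesis
      unfolding eq using assms(2) by (intro borel_approx_window C(1)) (simp add: k_def)
  qed
  then have "\<forall>v. \<exists>N B. prob {x \<in> X. (f x = v) \<noteq> (window N x \<in> B)} < \<delta> / k"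
    by blast
  then obtain N B where NB: "\<forall>v. prob {x \<in> X. (f x = v) \<noteq> (window (N v) x \<in> B v)} < \<delta> / k"
    unfolding choice_iff by (elim exE)
  define K where "K = Max (insert 0 (N ` ?V))"
  have K: "N v \<le> K" if "v \<in> ?V" for v
    unfolding K_def using that fin by (intro Max_ge) auto
  define h where "h w = (SOME v. v \<in> ?V \<and> window (N v) w \<in> B v)" for w
  let ?E = "\<lambda>v. {x \<in> X. (f x = v) \<noteq> (window (N v) x \<in> B v)}"
  have E: "?E v \<in> events" for v
  proof -
    have "?E v = (f -` {v} \<inter> space M - X \<inter> window (N v) -` B v) \<union> (X \<inter> window (N v) -` B v - f -` {v} \<inter> space M)"
      by (auto simp: space_M)
    then show ?thesis
      using simple_functionD(2)[OF f] window_vimage_in_events by auto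
  qed
  have "{x \<in> X. f x \<noteq> h (window K x)} \<subseteq> (\<Union>v\<in>?V. ?E v)"
  proof (rule subsetI, rule ccontr)
    fix x assume x: "x \<in> {x \<in> X. f x \<noteq> h (window K x)}" and nE: "x \<notin> (\<Union>v\<in>?V. ?E v)"
    have "(v \<in> ?V \<and> window (N v) (window K x) \<in> B v) \<longleftrightarrow> v = f x" for v
      using x nE K[of v] by (auto simp: window_window)
    then have "h (window K x) = f x"
      by (simp add: h_def)
    then show False using x by simp
  qed
  then have "prob {x \<in> X. f x \<noteq> h (window K x)} \<le> prob (\<Union>v\<in>?V. ?E v)"
    using fin E by (intro finite_measure_mono sets.finite_UN)
  also have "\<dots> \<le> (\<Sum>v\<in>?V. prob (?E v))"
    using fin E by (intro finite_measure_subadditive_finite) blast+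
  also have "\<dots> \<le> (\<Sum>v\<in>?V. \<delta> / k)"
    using NB by (intro sum_mono less_imp_le) blast
  also have "\<dots> < \<delta>"
    using assms(2) by (simp add: k_def field_simps)
  finally show ?thesis
    using that by blast
qed

end

section \<open>Local rules of cellular automata\<close>

lemma compact_configs: "compact (UNIV :: config set)"
proof -
  have "compact (UNIV :: bool set)"
    by (rule finite_imp_compact) simp
  then have "compact_space (product_topology (\<lambda>_ :: int. euclidean :: bool topology) UNIV)"
    unfolding compact_space_product_topology by (simp add: compact_space_def)
  then show ?thesis
    unfolding euclidean_product_topology by (simp add: compact_space_def)
qed

text \<open>Applied to the image of \<open>X\<close>, this makes its complement open, so that the
  support condition can be used there. Separation is inherited from the discrete factors.\<close>

lemma compact_configs_imp_closed:
  fixes K :: "config set"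
  assumes "compact K"
  shows "closed K"
proof -
  have "Hausdorff_space (euclidean :: bool topology)"
    unfolding Hausdorff_space_def
  proof (intro allI impI)
    fix x y :: bool
    assume "x \<in> topspace euclidean \<and> y \<in> topspace euclidean \<and> x \<noteq> y"
    then show "\<exists>U V. openin euclidean U \<and> openin euclidean V \<and> x \<in> U \<and> y \<in> V \<and> disjnt U V"
      by (intro exI[of _ "{x}"] exI[of _ "{y}"]) (simp add: discrete_topology_class.open_discrete)
  qed
  then have "Hausdorff_space (euclidean :: config topology)"
    by (simp add: euclidean_product_topology[symmetric] Hausdorff_space_product_topology)
  then show ?thesis
    using compactin_imp_closedin[of euclidean K] assms by simp
qed

lemma open_window_cylinder: "open {y. window N y = window N x}"
proof -
  have "{y. window N y = window N x} = (\<Inter>j\<in>{- int N..int N}. (\<lambda>y. y j) -` {x j})"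
    by (fastforce simp: window_eq_iff)
  also have "open \<dots>"
    by (intro open_INT ballI open_vimage discrete_topology_class.open_discrete
        continuous_on_product_coordinates) simp
  finally show ?thesis .
qed

lemma open_contains_window_cylinder:
  assumes "open U" "x \<in> U"
  obtains N where "{y. window N y = window N x} \<subseteq> U"
proof -
  have "openin (product_topology (\<lambda>_ :: int. euclidean :: bool topology) UNIV) U"
    using assms(1) by (simp add: euclidean_product_topology)
  from product_topology_open_contains_basis[OF this assms(2)]
  obtain V where V: "x \<in> Pi\<^sub>E UNIV V" "finite {i. V i \<noteq> UNIV}" "Pi\<^sub>E UNIV V \<subseteq> U"
    by auto
  define N where "N = Max (insert 0 ((\<lambda>i. nat \<bar>i\<bar>) ` {i. V i \<noteq> UNIV}))"
  have N: "\<bar>i\<bar> \<le> int N" if "V i \<noteq> UNIV" for i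
  proof -
    have "nat \<bar>i\<bar> \<le> N"
      unfolding N_def using V(2) that by (intro Max_ge) auto
    then show ?thesis by simp
  qed
  have "y \<in> Pi\<^sub>E UNIV V" if "window N y = window N x" for y
  proof (rule PiE_I)
    fix i
    show "y i \<in> V i"
    proof (cases "V i = UNIV")
      case False
      then have "y i = x i"
        using that N by (auto simp: window_eq_iff)
      then show ?thesis
        using V(1) by auto
    qed simp
  qed simp
  then show ?thesis
    using V(3) by (intro that[of N] order_trans[OF _ V(3)] subsetI) simp
qed

text \<open>Continuity gives each point its own window size. By compactness finitely many cylinders
  cover \<open>X\<close>, and the largest of their sizes works everywhere because a larger window
  determines a smaller one.\<close>

lemma continuous_on_window_uniform:
  fixes f :: "config \<Rightarrow> bool"
  assumes "closed X" "continuous_on X f"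
  obtains N where "\<And>x y. x \<in> X \<Longrightarrow> y \<in> X \<Longrightarrow> window N x = window N y \<Longrightarrow> f x = f y"
proof -
  have "\<exists>N. \<forall>y\<in>X. window N y = window N x \<longrightarrow> f y = f x" if "x \<in> X" for x
  proof -
    obtain U where U: "open U" "U \<inter> X = f -` {f x} \<inter> X"
      using assms(2)[unfolded continuous_on_open_invariant, rule_format,
          OF discrete_topology_class.open_discrete, of "{f x}"] by auto
    then have "x \<in> U"
      using that by blast
    with U(1) obtain N where N: "{y. window N y = window N x} \<subseteq> U"
      by (rule open_contains_window_cylinder)
    show ?thesis
    proof (intro exI ballI impI)
      fix y assume "y \<in> X" "window N y = window N x"
      then have "y \<in> U \<inter> X"
        using N by auto
      then show "f y = f x"
        unfolding U(2) by simp
    qed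
  qed
  then obtain N where N: "\<forall>x\<in>X. \<forall>y\<in>X. window (N x) y = window (N x) x \<longrightarrow> f y = f x"
    using bchoice[of X "\<lambda>x N. \<forall>y\<in>X. window N y = window N x \<longrightarrow> f y = f x"] by blast
  have "compact X"
    using compact_Int_closed[OF compact_configs assms(1)] by simp
  then obtain C where C: "C \<subseteq> X" "finite C" "X \<subseteq> (\<Union>x\<in>C. {y. window (N x) y = window (N x) x})"
    by (rule compactE_image[where S=X and C=X and f="\<lambda>x. {y. window (N x) y = window (N x) x}"])
      (use open_window_cylinder in auto)
  define K where "K = Max (insert 0 (N ` C))"
  show ?thesis
  proof (rule that[of K])
    fix x y assume xy: "x \<in> X" "y \<in> X" "window K x = window K y"
    then obtain c where c: "c \<in> C" "window (N c) x = window (N c) c"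
      using C(3) by blast
    have "N c \<le> K"
      unfolding K_def using C(2) c(1) by (intro Max_ge) auto
    then have "window (N c) y = window (N c) x"
      using xy(3) window_window by metis
    then show "f x = f y"
      using N c C(1) xy by (metis subsetD)
  qed
qed

section \<open>Equivariance and the radius\<close>

lemma shift_funpow: "(shift ^^ n) x = (\<lambda>j. x (j + int n))"
  by (induction n) (simp_all add: shift_def add_ac)

lemma cellular_automaton_translate:
  assumes "subshift X" "cellular_automaton X \<tau>" "x \<in> X"
  shows "(\<lambda>j. x (j + k)) \<in> X \<and> \<tau> (\<lambda>j. x (j + k)) = (\<lambda>j. \<tau> x (j + k))"
  using assms(3)
proof (induction k arbitrary: x rule: int_induct[where k=0])
  case base
  then show ?case by simp
next
  case (step1 k)
  have "shift x \<in> X" "\<tau> (shift x) = shift (\<tau> x)"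
    using assms(1,2) step1(3) by (auto simp: subshift_def cellular_automaton_def)
  then show ?case
    using step1(2)[of "shift x"] by (simp add: shift_def add_ac)
next
  case (step2 k)
  then obtain x' where x': "x' \<in> X" "x = shift x'"
    using assms(1) by (auto simp: subshift_def)
  then have "\<tau> x = shift (\<tau> x')"
    using assms(2) by (auto simp: cellular_automaton_def)
  then show ?case
    using step2(2)[OF x'(1)] x'(2) by (simp add: shift_def)
qed

text \<open>Locality in the sense of Curtis, Hedlund and Lyndon, phrased as a comparison of points
  of \<open>X\<close>, which avoids choosing a local rule on words.\<close>

definition has_radius :: "config set \<Rightarrow> (config \<Rightarrow> config) \<Rightarrow> nat \<Rightarrow> bool" where
  "has_radius X \<tau> r \<longleftrightarrow>
     (\<forall>x\<in>X. \<forall>y\<in>X. \<forall>j. (\<forall>i. \<bar>i - j\<bar> \<le> int r \<longrightarrow> x i = y i) \<longrightarrow> \<tau> x j = \<tau> y j)"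

lemma cellular_automaton_has_radius:
  assumes "subshift X" "cellular_automaton X \<tau>"
  obtains r where "has_radius X \<tau> r"
proof -
  have "continuous_on X (\<lambda>x. \<tau> x 0)"
    using assms(2) continuous_on_product_then_coordinatewise by (auto simp: cellular_automaton_def)
  with assms(1) obtain r where r: "\<And>x y. x \<in> X \<Longrightarrow> y \<in> X \<Longrightarrow> window r x = window r y \<Longrightarrow> \<tau> x 0 = \<tau> y 0"
    using continuous_on_window_uniform[of X "\<lambda>x. \<tau> x 0"] by (auto simp: subshift_def)
  show ?thesis
  proof (rule that[of r], unfold has_radius_def, intro ballI allI impI)
    fix x y j assume xy: "x \<in> X" "y \<in> X" "\<forall>i. \<bar>i - j\<bar> \<le> int r \<longrightarrow> x i = y i"
    have "\<tau> (\<lambda>i. x (i + j)) 0 = \<tau> (\<lambda>i. y (i + j)) 0"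
      using xy(1,2) cellular_automaton_translate[OF assms] by (intro r) (auto simp: window_eq_iff xy(3))
    then show "\<tau> x j = \<tau> y j"
      using xy(1,2) cellular_automaton_translate[OF assms] by auto
  qed
qed

section \<open>Truncation and finite blocks\<close>

definition truncate :: "int \<Rightarrow> int \<Rightarrow> config \<Rightarrow> config" where
  "truncate a c x = (\<lambda>j. a \<le> j \<and> j \<le> c \<and> x j)"

lemma truncate_in: "hereditary X \<Longrightarrow> x \<in> X \<Longrightarrow> truncate a c x \<in> X"
proof -
  have "truncate a c x \<le> x"
    by (auto simp: truncate_def)
  then show "hereditary X \<Longrightarrow> x \<in> X \<Longrightarrow> truncate a c x \<in> X"
    unfolding hereditary_def by blast
qed

text \<open>
  The image of a truncated configuration agrees with the image of the original one well inside
  the interval and with the image of the zero configuration well outside.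
\<close>

lemma pre_injective_interval:
  assumes "hereditary X" "pre_injective X \<tau>"
    and local: "has_radius X \<tau> r"
    and xy: "x \<in> X" "y \<in> X"
    and image: "\<And>j. a \<le> j \<Longrightarrow> j \<le> c \<Longrightarrow> \<tau> x j = \<tau> y j"
    and boundary: "\<And>j. j \<in> {a - int r..<a + int r} \<union> {c - int r<..c + int r} \<Longrightarrow>
      \<tau> (truncate a c x) j = \<tau> (truncate a c y) j"
    and j: "a \<le> j" "j \<le> c"
  shows "x j = y j"
proof -
  let ?x = "truncate a c x" and ?y = "truncate a c y"
  have X: "?x \<in> X" "?y \<in> X"
    using assms(1) xy by (auto intro: truncate_in)
  have "\<tau> ?x i = \<tau> ?y i" for i
  proof -
    \<comment> \<open>The half-open ends are sharp: the r-neighbourhood of \<open>a + int r\<close>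
      just fits into the interval, while that of \<open>a - int r\<close> still meets it. So each
      end costs 2r positions. For an interval shorter than 2r the middle case is void and the two
      boundary pieces overlap.\<close>
    consider "i \<in> {a - int r..<a + int r} \<union> {c - int r<..c + int r}"
      | "a + int r \<le> i" "i \<le> c - int r" | "i < a - int r \<or> i > c + int r"
      by fastforce
    then show ?thesis
    proof cases
      case 1
      then show ?thesis by (rule boundary)
    next
      case 2
      then have "\<And>k. \<bar>k - i\<bar> \<le> int r \<Longrightarrow> ?x k = x k" "\<And>k. \<bar>k - i\<bar> \<le> int r \<Longrightarrow> ?y k = y k"
        by (auto simp: truncate_def)
      then have "\<tau> ?x i = \<tau> x i" "\<tau> ?y i = \<tau> y i"
        using X xy local unfolding has_radius_def by blast+
      then show ?thesis
        using image 2 by simp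
    next
      case 3
      then have "\<And>k. \<bar>k - i\<bar> \<le> int r \<Longrightarrow> ?x k = ?y k"
        by (auto simp: truncate_def)
      then show ?thesis
        using X local unfolding has_radius_def by blast
    qed
  qed
  then have "\<tau> ?x = \<tau> ?y" by blast
  moreover have "finite {i. ?x i \<noteq> ?y i}"
    by (rule finite_subset[of _ "{a..c}"]) (auto simp: truncate_def)
  ultimately have "?x = ?y"
    using assms(2) X by (auto simp: pre_injective_def)
  then have "?x j = ?y j" by simp
  then show ?thesis
    using j by (simp add: truncate_def)
qed

text \<open>The windows centred at 0, ..., n - 1 together cover one interval of length 2N + n. For n
  = 0 the itinerary is empty and carries no information, although the interval on the right may be
  non-empty.\<close>

lemma itinerary_window_eq_iff:
  assumes "n > 0"
  shows "itinerary shift (window N) n x = itinerary shift (window N) n y \<longleftrightarrow>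
    (\<forall>j. - int N \<le> j \<and> j \<le> int N + int n - 1 \<longrightarrow> x j = y j)"
proof
  assume eq: "itinerary shift (window N) n x = itinerary shift (window N) n y"
  have *: "x (j + int i) = y (j + int i)" if "i < n" "\<bar>j\<bar> \<le> int N" for i j
    using eq that by (auto simp: itinerary_eq_iff window_eq_iff shift_funpow)
  show "\<forall>j. - int N \<le> j \<and> j \<le> int N + int n - 1 \<longrightarrow> x j = y j"
  proof (intro allI impI)
    fix j assume j: "- int N \<le> j \<and> j \<le> int N + int n - 1"
    show "x j = y j"
    \<comment> \<open>Coordinates up to N are seen at time 0; a later one is the right end of the
      window at time j - N.\<close>
    proof (cases "j \<le> int N")
      case True
      then show ?thesis using *[of 0 j] j assms by simp
    next
      case False
      then show ?thesis using *[of "nat (j - int N)" "int N"] j by auto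
    qed
  qed
next
  assume *: "\<forall>j. - int N \<le> j \<and> j \<le> int N + int n - 1 \<longrightarrow> x j = y j"
  show "itinerary shift (window N) n x = itinerary shift (window N) n y"
    by (auto simp: itinerary_eq_iff window_eq_iff shift_funpow intro!: *[rule_format])
qed

section \<open>Entropy under pre-injective cellular automata\<close>

context config_prob_space
begin

lemma measurable_continuous_self_map:
  assumes "continuous_on X \<tau>" "\<tau> ` X \<subseteq> X"
  shows "\<tau> \<in> measurable M M"
proof -
  have "\<tau> \<in> measurable (restrict_space borel X) (restrict_space borel X)"
    using assms by (intro measurable_restrict_space2 borel_measurable_continuous_on_restrict)
      (auto simp: space_restrict_space)
  then show ?thesis
    using measurable_cong_sets[OF sets_M sets_M] by simp
qed

text \<open>What matters is that the loss depends neither on \<open>n\<close> nor on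
  \<open>N\<close>.\<close>

lemma fun_entropy_window_image:
  assumes "hereditary X" "pre_injective X \<tau>" "\<tau> \<in> measurable M M" "shift \<in> measurable M M"
    and local: "has_radius X \<tau> r"
  shows "fun_entropy M (itinerary shift (window N) n)
    \<le> fun_entropy M (itinerary shift (window N) n \<circ> \<tau>) + 4 * real r * ln 2"
proof (cases "n = 0")
  case True
  have "itinerary shift (window N) 0 = (\<lambda>_. [])"
    by (simp add: itinerary_def fun_eq_iff)
  then show ?thesis
    using True by (simp add: comp_def)
next
  case False
  define a where "a = - int N"
  define c where "c = int N + int n - 1"
  define B where "B = {a - int r..<a + int r} \<union> {c - int r<..c + int r}"
  \<comment> \<open>The missing information: the image of the cut point near the two ends. Blanking
    all other positions leaves at most 2 ^ (4r) values.\<close>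
  define b where "b x = (\<lambda>j. j \<in> B \<and> \<tau> (truncate a c x) j)" for x
  have itin: "itinerary shift (window N) n x = itinerary shift (window N) n y \<longleftrightarrow>
    (\<forall>j. a \<le> j \<and> j \<le> c \<longrightarrow> x j = y j)" for x y
    using False unfolding a_def c_def by (intro itinerary_window_eq_iff) simp
  \<comment> \<open>Since [a, c] lies in [-(N + n), N + n], \<open>b\<close> factors through a
    window and is therefore simple.\<close>
  have "truncate a c (window (N + n) x) = truncate a c x" for x
    by (auto simp: truncate_def window_def a_def c_def fun_eq_iff)
  then have "b = b \<circ> window (N + n)"
    by (intro ext) (simp add: b_def)
  then have b: "simple_function M b"
    using simple_function_compose[OF simple_function_window, of b "N + n"] by simp
  have i\<tau>: "simple_function M (itinerary shift (window N) n \<circ> \<tau>)"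
    using assms(3) by (rule simple_function_comp_measurable)
      (intro simple_function_itinerary simple_function_window assms(4))
  have "finite B" "card B \<le> 4 * r"
  proof -
    show "finite B" by (simp add: B_def)
    have "card B \<le> card {a - int r..<a + int r} + card {c - int r<..c + int r}"
      unfolding B_def by (rule card_Un_le)
    then show "card B \<le> 4 * r" by simp
  qed
  have "b ` space M \<subseteq> {x. \<forall>j. x j \<longrightarrow> j \<in> B}"
    by (auto simp: b_def)
  from card_mono[OF finite_supported_configs(1)[OF \<open>finite B\<close>] this]
  have "card (b ` space M) \<le> 2 ^ card B"
    unfolding finite_supported_configs(2)[OF \<open>finite B\<close>] .
  also have "\<dots> \<le> 2 ^ (4 * r)"
    using \<open>card B \<le> 4 * r\<close> by (intro power_increasing) auto
  finally have "real (card (b ` space M)) \<le> real (2 ^ (4 * r))"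
    by (rule of_nat_mono)
  moreover have "card (b ` space M) > 0"
    using simple_functionD(1)[OF b] not_empty by (simp add: card_gt_0_iff)
  ultimately have "ln (card (b ` space M)) \<le> ln (real (2 ^ (4 * r)))"
    by (subst ln_le_cancel_iff) auto
  then have card: "ln (card (b ` space M)) \<le> 4 * real r * ln 2"
    by (simp add: ln_realpow)
  have "fun_entropy M (itinerary shift (window N) n)
    \<le> fun_entropy M (\<lambda>x. ((itinerary shift (window N) n \<circ> \<tau>) x, b x))"
  proof (intro fun_entropy_mono simple_function_Pair i\<tau> b)
    fix x y
    assume xy: "x \<in> space M" "y \<in> space M"
      and eq: "((itinerary shift (window N) n \<circ> \<tau>) x, b x) = ((itinerary shift (window N) n \<circ> \<tau>) y, b y)"
    have "\<tau> (truncate a c x) j = \<tau> (truncate a c y) j" if "j \<in> B" for j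
      using eq that by (auto simp: b_def fun_eq_iff)
    moreover have "\<tau> x j = \<tau> y j" if "a \<le> j" "j \<le> c" for j
      using eq that by (auto simp: itin)
    ultimately have "x j = y j" if "a \<le> j" "j \<le> c" for j
      using that xy unfolding space_M B_def
      by (intro pre_injective_interval[OF assms(1,2) local, of x y a c j])
    then show "itinerary shift (window N) n x = itinerary shift (window N) n y"
      by (simp add: itin)
  qed
  also have "\<dots> \<le> fun_entropy M (itinerary shift (window N) n \<circ> \<tau>) + fun_entropy M b"
    by (intro fun_entropy_Pair_le i\<tau> b)
  also have "\<dots> \<le> fun_entropy M (itinerary shift (window N) n \<circ> \<tau>) + 4 * real r * ln 2"
    using fun_entropy_le_ln_card[OF b] card by simp
  finally show ?thesis .
qed

end

section \<open>Entropy of the image measure\<close>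

lemma limsup_le_add:
  fixes a b :: "nat \<Rightarrow> real"
  assumes "eventually (\<lambda>n. a n \<le> b n + e) sequentially"
  shows "limsup (\<lambda>n. ereal (a n)) \<le> limsup (\<lambda>n. ereal (b n)) + ereal e"
proof -
  have "limsup (\<lambda>n. ereal (a n)) \<le> limsup (\<lambda>n. ereal (b n) + ereal e)"
    using assms by (intro Limsup_mono) (auto elim: eventually_mono)
  also have "\<dots> = limsup (\<lambda>n. ereal (b n)) + ereal e"
    by (rule Limsup_add_ereal_right) auto
  finally show ?thesis .
qed

locale shift_system = config_prob_space M X + measure_preserving_system M shift for M X
begin

text \<open>The Kolmogorov-Sinai approximation in finite form. \<open>N\<close> is chosen before
  \<open>n\<close>, so one window serves all block lengths, with a loss of at most \<epsilon> per
  symbol.\<close>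

lemma fun_entropy_itinerary_le_window:
  fixes \<epsilon> :: real
  assumes f: "simple_function M f" and "\<epsilon> > 0"
  obtains N where "\<And>n. fun_entropy M (itinerary shift f n)
    \<le> fun_entropy M (itinerary shift (window N) n) + n * \<epsilon>"
proof -
  let ?k = "real (card (f ` space M))"
  \<comment> \<open>The bound of \<open>fun_entropy_error_le\<close> tends to 0 with \<delta>; this
    fixes how well \<open>f\<close> has to be approximated.\<close>
  have "((\<lambda>\<delta>. \<delta> + 2 * ?k * sqrt \<delta>) \<longlongrightarrow> 0 + 2 * ?k * sqrt 0) (at_right 0)"
    by (intro tendsto_intros)
  then have "eventually (\<lambda>\<delta>. \<delta> + 2 * ?k * sqrt \<delta> < \<epsilon>) (at_right 0)"
    using assms(2) by (intro order_tendstoD(2)) auto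
  moreover have "eventually (\<lambda>\<delta> :: real. 0 < \<delta> \<and> \<delta> < 1) (at_right 0)"
    by (auto simp: eventually_at_right_field intro!: exI[of _ 1])
  ultimately have "eventually (\<lambda>\<delta>. \<delta> + 2 * ?k * sqrt \<delta> < \<epsilon> \<and> 0 < \<delta> \<and> \<delta> < 1) (at_right 0)"
    by (rule eventually_conj)
  then obtain \<delta> where \<delta>: "\<delta> + 2 * ?k * sqrt \<delta> < \<epsilon>" "0 < \<delta>" "\<delta> < 1"
    using eventually_happens'[OF trivial_limit_at_right_real] by blast
  obtain N h where Nh: "prob {x \<in> X. f x \<noteq> h (window N x)} < \<delta>"
    using simple_function_approx_window[OF f \<delta>(2)] by blast
  define g where "g = h \<circ> window N"
  have g: "simple_function M g"
    unfolding g_def by (intro simple_function_compose simple_function_window)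
  let ?e = "\<lambda>x. if f x = g x then None else Some (f x)"
  have "fun_entropy M ?e \<le> \<delta> + 2 * ?k * sqrt \<delta>"
    using Nh \<delta>(3) by (intro fun_entropy_error_le f g) (auto simp: g_def space_M)
  then have e: "fun_entropy M ?e \<le> \<epsilon>"
    using \<delta>(1) by simp
  show ?thesis
  proof (rule that[of N])
    fix n
    have "fun_entropy M (itinerary shift f n) \<le> fun_entropy M (itinerary shift g n) + n * fun_entropy M ?e"
      using f g by (rule fun_entropy_itinerary_approx)
    also have "fun_entropy M (itinerary shift g n) \<le> fun_entropy M (itinerary shift (window N) n)"
      by (intro fun_entropy_mono simple_function_itinerary T simple_function_window)
        (auto simp: itinerary_eq_iff g_def)
    also have "n * fun_entropy M ?e \<le> n * \<epsilon>"
      using e by (intro mult_left_mono) auto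
    finally show "fun_entropy M (itinerary shift f n)
      \<le> fun_entropy M (itinerary shift (window N) n) + n * \<epsilon>" by simp
  qed
qed

lemma measure_entropy_image:
  assumes "subshift X" "hereditary X" "cellular_automaton X \<tau>" "pre_injective X \<tau>"
  shows "measure_entropy (distr M M \<tau>) shift = measure_entropy M shift"
proof (rule antisym)
  let ?\<nu> = "distr M M \<tau>"
  have \<tau>: "\<tau> \<in> measurable M M"
    using assms(3) by (intro measurable_continuous_self_map) (auto simp: cellular_automaton_def)
  have commute: "\<tau> ((shift ^^ i) x) = (shift ^^ i) (\<tau> x)" if "x \<in> X" for x i
    using cellular_automaton_translate[OF assms(1,3) that, of "int i"] by (simp add: shift_funpow)
  \<comment> \<open>Being simple depends only on the space and the measurable sets, which the image
    measure shares with \<open>M\<close>.\<close>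
  have simple: "simple_function ?\<nu> f \<longleftrightarrow> simple_function M f" for f :: "config \<Rightarrow> 'c"
    by (simp add: simple_function_def)
  have shift_\<nu>: "shift \<in> measurable ?\<nu> ?\<nu>"
    using T by simp
  have itin_\<nu>: "fun_entropy ?\<nu> (itinerary shift f n) = fun_entropy M (itinerary shift f n \<circ> \<tau>)"
    if "simple_function M f" for f :: "config \<Rightarrow> 'c" and n
    by (intro fun_entropy_distr \<tau> simple_function_itinerary T that)
  \<comment> \<open>The factor direction: a partition for the image measure is pulled back along
    \<tau>, and its itineraries pull back as well because \<tau> commutes with the shift.\<close>
  show "measure_entropy ?\<nu> shift \<le> measure_entropy M shift"
    unfolding measure_entropy_def[of ?\<nu>]
  proof (rule SUP_least)
    fix P assume "P \<in> {P. finite_measurable_partition ?\<nu> P}"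
    then have "finite_measurable_partition ?\<nu> P" by simp
    then obtain f :: "config \<Rightarrow> config set" where "simple_function ?\<nu> f" and P: "P = level_sets ?\<nu> f"
      by (rule finite_measurable_partition_eq_level_sets)
    then have f: "simple_function M f" by (simp add: simple)
    have f\<tau>: "simple_function M (f \<circ> \<tau>)"
      using \<tau> f by (rule simple_function_comp_measurable)
    have "partition_entropy_rate ?\<nu> shift P =
      limsup (\<lambda>n. ereal (fun_entropy ?\<nu> (itinerary shift f n) / real n))"
      unfolding P using shift_\<nu> f by (intro partition_entropy_rate_level_sets) (simp_all add: simple)
    also have "\<dots> = limsup (\<lambda>n. ereal (fun_entropy M (itinerary shift (f \<circ> \<tau>) n) / real n))"
    proof -
      have "fun_entropy ?\<nu> (itinerary shift f n) = fun_entropy M (itinerary shift (f \<circ> \<tau>) n)" for n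
        unfolding itin_\<nu>[OF f] by (rule fun_entropy_cong) (simp add: itinerary_def commute space_M)
      then show ?thesis by simp
    qed
    also have "\<dots> = partition_entropy_rate M shift (level_sets M (f \<circ> \<tau>))"
      by (intro partition_entropy_rate_level_sets[symmetric] T f\<tau>)
    also have "\<dots> \<le> measure_entropy M shift"
      by (intro partition_entropy_rate_le_measure_entropy finite_measurable_partition_level_sets f\<tau>)
    finally show "partition_entropy_rate ?\<nu> shift P \<le> measure_entropy M shift" .
  qed
  obtain r where r: "has_radius X \<tau> r"
    using assms(1,3) by (rule cellular_automaton_has_radius)
  show "measure_entropy M shift \<le> measure_entropy ?\<nu> shift"
    unfolding measure_entropy_def[of M]
  proof (rule SUP_least, rule ereal_le_epsilon2)
    fix P and \<epsilon> :: real
    assume "P \<in> {P. finite_measurable_partition M P}" and "0 < \<epsilon>"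
    then have "finite_measurable_partition M P" by simp
    then obtain f :: "config \<Rightarrow> config set" where f: "simple_function M f" "P = level_sets M f"
      by (rule finite_measurable_partition_eq_level_sets)
    \<comment> \<open>Half of \<epsilon> is spent on passing to windows; the other half absorbs 4r
      ln 2 / n once n is large.\<close>
    obtain N where N: "\<And>n. fun_entropy M (itinerary shift f n)
        \<le> fun_entropy M (itinerary shift (window N) n) + n * (\<epsilon> / 2)"
      using fun_entropy_itinerary_le_window[OF f(1), of "\<epsilon> / 2"] \<open>0 < \<epsilon>\<close> by auto
    have "(\<lambda>n. 4 * real r * ln 2 / real n) \<longlonglongrightarrow> 0"
      by (rule lim_const_over_n)
    then have "eventually (\<lambda>n. 4 * real r * ln 2 / real n < \<epsilon> / 2) sequentially"
      using \<open>0 < \<epsilon>\<close> by (intro order_tendstoD(2)) auto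
    then have "eventually (\<lambda>n. fun_entropy M (itinerary shift f n) / real n
      \<le> fun_entropy ?\<nu> (itinerary shift (window N) n) / real n + \<epsilon>) sequentially"
      using eventually_gt_at_top[of 0]
    proof eventually_elim
      case (elim n)
      have "fun_entropy M (itinerary shift f n)
        \<le> fun_entropy ?\<nu> (itinerary shift (window N) n) + 4 * real r * ln 2 + n * (\<epsilon> / 2)"
        using N[of n] fun_entropy_window_image[OF assms(2,4) \<tau> T r, of N n]
          itin_\<nu>[OF simple_function_window, of N n] by linarith
      then have "fun_entropy M (itinerary shift f n) / n
        \<le> (fun_entropy ?\<nu> (itinerary shift (window N) n) + 4 * real r * ln 2 + n * (\<epsilon> / 2)) / n"
        by (intro divide_right_mono) auto
      also have "\<dots> = fun_entropy ?\<nu> (itinerary shift (window N) n) / n + 4 * real r * ln 2 / real n + \<epsilon> / 2"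
        using elim by (simp add: add_divide_distrib)
      finally show ?case
        using elim by linarith
    qed
    then have "partition_entropy_rate M shift P
      \<le> limsup (\<lambda>n. ereal (fun_entropy ?\<nu> (itinerary shift (window N) n) / real n)) + ereal \<epsilon>"
      unfolding f(2) partition_entropy_rate_level_sets[OF T f(1)] by (rule limsup_le_add)
    also have "limsup (\<lambda>n. ereal (fun_entropy ?\<nu> (itinerary shift (window N) n) / real n)) =
      partition_entropy_rate ?\<nu> shift (level_sets ?\<nu> (window N))"
      using shift_\<nu> simple_function_window
      by (intro partition_entropy_rate_level_sets[symmetric]) (simp_all add: simple)
    also have "\<dots> \<le> measure_entropy ?\<nu> shift"
      using simple_function_window
      by (intro partition_entropy_rate_le_measure_entropy finite_measurable_partition_level_sets)
        (simp add: simple)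
    finally show "partition_entropy_rate M shift P \<le> measure_entropy ?\<nu> shift + ereal \<epsilon>"
      by (simp add: add_right_mono)
  qed
qed

lemma invariant_prob_measure_image:
  assumes "cellular_automaton X \<tau>"
  shows "invariant_prob_measure X (distr M M \<tau>)"
proof -
  have \<tau>: "\<tau> \<in> measurable M M"
    using assms by (intro measurable_continuous_self_map) (auto simp: cellular_automaton_def)
  have "distr (distr M M \<tau>) (distr M M \<tau>) shift = distr (distr M M \<tau>) M shift"
    by (rule distr_cong) auto
  also have "\<dots> = distr M M (shift \<circ> \<tau>)"
    by (rule distr_distr[OF T \<tau>])
  also have "\<dots> = distr M M (\<tau> \<circ> shift)"
    using assms by (intro distr_cong) (auto simp: cellular_automaton_def space_M)
  also have "\<dots> = distr (distr M M shift) M \<tau>"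
    by (rule distr_distr[OF \<tau> T, symmetric])
  finally have "distr (distr M M \<tau>) (distr M M \<tau>) shift = distr M M \<tau>"
    by (simp add: distr_T)
  then show ?thesis
    using sets_M T prob_space_distr[OF \<tau>] by (simp add: invariant_prob_measure_def)
qed

end

theorem proposition4p5:
  fixes X :: "config set" and \<mu> :: "config measure"
  assumes "subshift X"
    and "hereditary X"
    and "intrinsically_ergodic X"
    and "max_entropy_measure X \<mu>"
    and "measure_support \<mu> = X"
  shows "Myhill_property X"
  unfolding Myhill_property_def
proof (intro allI impI, elim conjE)
  fix \<tau> assume ca: "cellular_automaton X \<tau>" and inj: "pre_injective X \<tau>"
  interpret shift_system \<mu> X
    using assms(4)
    by (simp add: max_entropy_measure_def invariant_prob_measure_def shift_system_def
        config_prob_space_def config_prob_space_axioms_def measure_preserving_system_def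
        measure_preserving_system_axioms_def)
  have \<tau>: "\<tau> \<in> measurable \<mu> \<mu>" and cont: "continuous_on X \<tau>" and sub: "\<tau> ` X \<subseteq> X"
    using ca by (auto simp: cellular_automaton_def intro: measurable_continuous_self_map)
  \<comment> \<open>The topological entropy depends on \<open>X\<close> alone, so maximality passes
    to the image once the two measure entropies agree.\<close>
  have "max_entropy_measure X (distr \<mu> \<mu> \<tau>)"
    using assms(4) invariant_prob_measure_image[OF ca] measure_entropy_image[OF assms(1,2) ca inj]
    by (simp add: max_entropy_measure_def)
  then have eq: "distr \<mu> \<mu> \<tau> = \<mu>"
    using assms(3,4) unfolding intrinsically_ergodic_def by blast
  have "compact X"
    using compact_Int_closed[OF compact_configs] assms(1) by (auto simp: subshift_def)
  then have closed: "closed (\<tau> ` X)"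
    using cont by (intro compact_configs_imp_closed compact_continuous_image)
  show "\<tau> ` X = X"
  proof (rule antisym[OF sub], rule subsetI, rule ccontr)
    fix x assume x: "x \<in> X" "x \<notin> \<tau> ` X"
    have "emeasure \<mu> (- \<tau> ` X \<inter> space \<mu>) > 0"
      using x closed assms(5) unfolding measure_support_def by blast
    moreover have "- \<tau> ` X \<inter> space \<mu> \<in> sets \<mu>"
      using closed Int_in_events[of "- \<tau> ` X"] by (simp add: space_M Int_commute)
    then have "emeasure \<mu> (- \<tau> ` X \<inter> space \<mu>) = emeasure \<mu> (\<tau> -` (- \<tau> ` X \<inter> space \<mu>) \<inter> space \<mu>)"
      by (metis eq emeasure_distr[OF \<tau>])
    moreover have "\<tau> -` (- \<tau> ` X \<inter> space \<mu>) \<inter> space \<mu> = {}"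
      by (auto simp: space_M)
    ultimately show False by simp
  qed
qed

end
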